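(* Let $J:\mathbf{M}\to\overline{\mathbf{M}}$ be a homothetic map with constant dilation factor $c\notin\{0,1\}$ between smooth surfaces in $\mathbb{E}^3$, let $\varphi(u,v)$ be a surface patch of $\mathbf{M}$, and let $\alpha(s)=\varphi(u(s),v(s))$ be a unit speed rectifying curve on $\mathbf{M}$ such that $\overline{\alpha}=J\circ\alpha$ is a rectifying curve on $\overline{\mathbf{M}}$. Then the geodesic curvature of $\alpha$ is homothetic invariant under $J$, i.e. there is a constant $k\notin\{0,1\}$ such that $\overline{\kappa}_g=k^2\kappa_g$ along the curve.
   Context: Primes denote $d/ds$. A curve in $\mathbb{E}^3$ is a rectifying curve if its position vector is orthogonal to its principal normal $\vec n$, i.e. lies in the span of its unit tangent and binormal at every point. A homothetic map with dilation factor $c$ is a diffeomorphism $J$ for which the first fundamental form coefficients of $\varphi$ and $\overline{\varphi}=J\circ\varphi$ satisfy $\overline{E}=c^2E$, $\overline{F}=c^2F$, $\overline{G}=c^2G$ with $c$ constant. A quantity $f$ on $\mathbf M$ with counterpart $\overline f$ on $\overline{\mathbf M}$ is called homothetic invariant if $\overline f=k^2f$ for some constant $k\notin\{0,1\}$. The geodesic curvature of the unit speed curve $\alpha$ is defined by $\alpha''=\kappa_n\mathbf{U}+\kappa_g\,\mathbf{U}\times\alpha'$ with $\mathbf{U}$ the unit surface normal in the direction of $\varphi_u\times\varphi_v$; equivalently $$\kappa_g=\Big[\Gamma_{11}^2{u'}^3+(2\Gamma_{12}^2-\Gamma_{11}^1){u'}^2v'+(\Gamma_{22}^2-2\Gamma_{12}^1)u'{v'}^2-\Gamma_{22}^1{v'}^3+u'v''-u''v'\Big]\sqrt{EG-F^2},$$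 with $\Gamma_{ij}^k$ the Christoffel symbols of $\varphi$. The quantity $\overline\kappa_g$ is given by the same expression with $\Gamma_{ij}^k,E,F,G$ replaced by $\overline\Gamma_{ij}^k,\overline E,\overline F,\overline G$ (those of $\overline\varphi$) and with the same functions $u(s),v(s)$ and the same parameter $s$. *)

theory Defs
  imports "HOL-Analysis.Analysis"
begin

text \<open>Only used with \<open>S\<close> open, where Frechet derivatives in the ambient space are the right ones.\<close>

fun Ck_on :: "nat \<Rightarrow> 'a::euclidean_space set \<Rightarrow> ('a \<Rightarrow> 'b::real_normed_vector) \<Rightarrow> bool" where
  "Ck_on 0 S f \<longleftrightarrow> continuous_on S f"
| "Ck_on (Suc k) S f \<longleftrightarrow> f differentiable_on S \<and>
     (\<forall>b\<in>Basis. Ck_on k S (\<lambda>x. frechet_derivative f (at x) b))"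

definition smooth_on :: "'a::euclidean_space set \<Rightarrow> ('a \<Rightarrow> 'b::real_normed_vector) \<Rightarrow> bool" where
  "smooth_on S f \<longleftrightarrow> (\<forall>k. Ck_on k S f)"

definition partial_u :: "(real \<times> real \<Rightarrow> 'b::real_normed_vector) \<Rightarrow> real \<times> real \<Rightarrow> 'b" where
  "partial_u f p = vector_derivative (\<lambda>t. f (t, snd p)) (at (fst p))"

definition partial_v :: "(real \<times> real \<Rightarrow> 'b::real_normed_vector) \<Rightarrow> real \<times> real \<Rightarrow> 'b" where
  "partial_v f p = vector_derivative (\<lambda>t. f (fst p, t)) (at (snd p))"

definition surface_patch :: "(real^3) set \<Rightarrow> (real \<times> real) set \<Rightarrow> (real \<times> real \<Rightarrow> real^3) \<Rightarrow> bool" where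
  "surface_patch M D \<phi> \<longleftrightarrow>
     open D \<and> smooth_on D \<phi> \<and>
     openin (top_of_set M) (\<phi> ` D) \<and>
     inj_on \<phi> D \<and> continuous_on (\<phi> ` D) (inv_into D \<phi>) \<and>
     (\<forall>p\<in>D. cross3 (partial_u \<phi> p) (partial_v \<phi> p) \<noteq> 0)"

definition smooth_surface :: "(real^3) set \<Rightarrow> bool" where
  "smooth_surface M \<longleftrightarrow> (\<forall>x\<in>M. \<exists>D \<phi>. surface_patch M D \<phi> \<and> x \<in> \<phi> ` D)"

text \<open>Continuity of \<open>f\<close> makes the domain of every coordinate representation open.\<close>

definition smooth_surface_map :: "(real^3) set \<Rightarrow> (real^3) set \<Rightarrow> (real^3 \<Rightarrow> real^3) \<Rightarrow> bool" where
  "smooth_surface_map M N f \<longleftrightarrow>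
     continuous_on M f \<and> f ` M \<subseteq> N \<and>
     (\<forall>D \<phi> D' \<psi>. surface_patch M D \<phi> \<and> surface_patch N D' \<psi> \<longrightarrow>
        smooth_on {p \<in> D. f (\<phi> p) \<in> \<psi> ` D'} (inv_into D' \<psi> \<circ> f \<circ> \<phi>))"

definition surface_diffeomorphism :: "(real^3) set \<Rightarrow> (real^3) set \<Rightarrow> (real^3 \<Rightarrow> real^3) \<Rightarrow> bool" where
  "surface_diffeomorphism M N f \<longleftrightarrow>
     bij_betw f M N \<and> smooth_surface_map M N f \<and> smooth_surface_map N M (inv_into M f)"

definition coef_E :: "(real \<times> real \<Rightarrow> real^3) \<Rightarrow> real \<times> real \<Rightarrow> real" where
  "coef_E \<phi> p = partial_u \<phi> p \<bullet> partial_u \<phi> p"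

definition coef_F :: "(real \<times> real \<Rightarrow> real^3) \<Rightarrow> real \<times> real \<Rightarrow> real" where
  "coef_F \<phi> p = partial_u \<phi> p \<bullet> partial_v \<phi> p"

definition coef_G :: "(real \<times> real \<Rightarrow> real^3) \<Rightarrow> real \<times> real \<Rightarrow> real" where
  "coef_G \<phi> p = partial_v \<phi> p \<bullet> partial_v \<phi> p"

definition metric_det :: "(real \<times> real \<Rightarrow> real^3) \<Rightarrow> real \<times> real \<Rightarrow> real" where
  "metric_det \<phi> p = coef_E \<phi> p * coef_G \<phi> p - (coef_F \<phi> p)\<^sup>2"

definition homothetic_map :: "(real^3) set \<Rightarrow> (real^3) set \<Rightarrow> real \<Rightarrow> (real^3 \<Rightarrow> real^3) \<Rightarrow> bool" where
  "homothetic_map M N c J \<longleftrightarrow>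
     surface_diffeomorphism M N J \<and>
     (\<forall>D \<phi>. surface_patch M D \<phi> \<longrightarrow>
        (\<forall>p\<in>D. coef_E (J \<circ> \<phi>) p = c\<^sup>2 * coef_E \<phi> p \<and>
               coef_F (J \<circ> \<phi>) p = c\<^sup>2 * coef_F \<phi> p \<and>
               coef_G (J \<circ> \<phi>) p = c\<^sup>2 * coef_G \<phi> p))"

text \<open>\<open>christoffel_ij_k\<close> is the symbol with lower indices \<open>i j\<close> and upper index \<open>k\<close>,
  where index 1 refers to \<open>u\<close> and index 2 to \<open>v\<close>.\<close>

definition christoffel_11_1 :: "(real \<times> real \<Rightarrow> real^3) \<Rightarrow> real \<times> real \<Rightarrow> real" where
  "christoffel_11_1 \<phi> p =
     (coef_G \<phi> p * partial_u (coef_E \<phi>) p - 2 * coef_F \<phi> p * partial_u (coef_F \<phi>) p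
        + coef_F \<phi> p * partial_v (coef_E \<phi>) p) / (2 * metric_det \<phi> p)"

definition christoffel_11_2 :: "(real \<times> real \<Rightarrow> real^3) \<Rightarrow> real \<times> real \<Rightarrow> real" where
  "christoffel_11_2 \<phi> p =
     (2 * coef_E \<phi> p * partial_u (coef_F \<phi>) p - coef_E \<phi> p * partial_v (coef_E \<phi>) p
        - coef_F \<phi> p * partial_u (coef_E \<phi>) p) / (2 * metric_det \<phi> p)"

definition christoffel_12_1 :: "(real \<times> real \<Rightarrow> real^3) \<Rightarrow> real \<times> real \<Rightarrow> real" where
  "christoffel_12_1 \<phi> p =
     (coef_G \<phi> p * partial_v (coef_E \<phi>) p - coef_F \<phi> p * partial_u (coef_G \<phi>) p)
       / (2 * metric_det \<phi> p)"

definition christoffel_12_2 :: "(real \<times> real \<Rightarrow> real^3) \<Rightarrow> real \<times> real \<Rightarrow> real" where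
  "christoffel_12_2 \<phi> p =
     (coef_E \<phi> p * partial_u (coef_G \<phi>) p - coef_F \<phi> p * partial_v (coef_E \<phi>) p)
       / (2 * metric_det \<phi> p)"

definition christoffel_22_1 :: "(real \<times> real \<Rightarrow> real^3) \<Rightarrow> real \<times> real \<Rightarrow> real" where
  "christoffel_22_1 \<phi> p =
     (2 * coef_G \<phi> p * partial_v (coef_F \<phi>) p - coef_G \<phi> p * partial_u (coef_G \<phi>) p
        - coef_F \<phi> p * partial_v (coef_G \<phi>) p) / (2 * metric_det \<phi> p)"

definition christoffel_22_2 :: "(real \<times> real \<Rightarrow> real^3) \<Rightarrow> real \<times> real \<Rightarrow> real" where
  "christoffel_22_2 \<phi> p =
     (coef_E \<phi> p * partial_v (coef_G \<phi>) p - 2 * coef_F \<phi> p * partial_v (coef_F \<phi>) p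
        + coef_F \<phi> p * partial_u (coef_G \<phi>) p) / (2 * metric_det \<phi> p)"

definition velocity :: "(real \<Rightarrow> real^3) \<Rightarrow> real \<Rightarrow> real^3" where
  "velocity \<gamma> s = vector_derivative \<gamma> (at s)"

definition acceleration :: "(real \<Rightarrow> real^3) \<Rightarrow> real \<Rightarrow> real^3" where
  "acceleration \<gamma> = velocity (velocity \<gamma>)"

definition unit_speed_on :: "real set \<Rightarrow> (real \<Rightarrow> real^3) \<Rightarrow> bool" where
  "unit_speed_on I \<gamma> \<longleftrightarrow> (\<forall>s\<in>I. norm (velocity \<gamma> s) = 1)"

text \<open>The Frenet frame is defined for an arbitrary regular parameter, since the image of a unit
  speed curve under a homothetic map need not have unit speed.\<close>

definition unit_tangent :: "(real \<Rightarrow> real^3) \<Rightarrow> real \<Rightarrow> real^3" where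
  "unit_tangent \<gamma> s = velocity \<gamma> s /\<^sub>R norm (velocity \<gamma> s)"

definition principal_normal :: "(real \<Rightarrow> real^3) \<Rightarrow> real \<Rightarrow> real^3" where
  "principal_normal \<gamma> s =
     velocity (unit_tangent \<gamma>) s /\<^sub>R norm (velocity (unit_tangent \<gamma>) s)"

text \<open>The two nonvanishing conditions (regularity, nonzero curvature) say that the Frenet frame
  exists at every point.\<close>

definition rectifying_curve :: "real set \<Rightarrow> (real \<Rightarrow> real^3) \<Rightarrow> bool" where
  "rectifying_curve I \<gamma> \<longleftrightarrow>
     smooth_on I \<gamma> \<and>
     (\<forall>s\<in>I. velocity \<gamma> s \<noteq> 0 \<and> velocity (unit_tangent \<gamma>) s \<noteq> 0 \<and>
            \<gamma> s \<bullet> principal_normal \<gamma> s = 0)"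

definition unit_normal :: "(real \<times> real \<Rightarrow> real^3) \<Rightarrow> real \<times> real \<Rightarrow> real^3" where
  "unit_normal \<phi> p =
     cross3 (partial_u \<phi> p) (partial_v \<phi> p) /\<^sub>R norm (cross3 (partial_u \<phi> p) (partial_v \<phi> p))"

text \<open>For a unit speed curve the scalar below exists and is unique, since the acceleration is
  orthogonal to the velocity and the unit normal, the velocity and their cross product
  form an orthonormal frame.\<close>

definition geodesic_curvature ::
  "(real \<times> real \<Rightarrow> real^3) \<Rightarrow> (real \<Rightarrow> real) \<Rightarrow> (real \<Rightarrow> real) \<Rightarrow> real \<Rightarrow> real" where
  "geodesic_curvature \<phi> u v s =
     (let \<alpha> = (\<lambda>t. \<phi> (u t, v t)); U = unit_normal \<phi> (u s, v s) in
      THE \<kappa>g. \<exists>\<kappa>n. acceleration \<alpha> s = \<kappa>n *\<^sub>R U + \<kappa>g *\<^sub>R cross3 U (velocity \<alpha> s))"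

text \<open>The coordinate expression of the geodesic curvature. It agrees with
  \<open>geodesic_curvature\<close> for unit speed curves; for the image patch of a homothetic map it is
  evaluated at the unchanged \<open>u\<close>, \<open>v\<close> and parameter \<open>s\<close>, although the
  image curve need not be unit speed with respect to \<open>s\<close>.\<close>

definition geodesic_curvature_expr ::
  "(real \<times> real \<Rightarrow> real^3) \<Rightarrow> (real \<Rightarrow> real) \<Rightarrow> (real \<Rightarrow> real) \<Rightarrow> real \<Rightarrow> real" where
  "geodesic_curvature_expr \<phi> u v s =
     (let p = (u s, v s);
          u' = deriv u s; v' = deriv v s;
          u'' = deriv (deriv u) s; v'' = deriv (deriv v) s in
      (christoffel_11_2 \<phi> p * u' ^ 3
       + (2 * christoffel_12_2 \<phi> p - christoffel_11_1 \<phi> p) * u'\<^sup>2 * v'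
       + (christoffel_22_2 \<phi> p - 2 * christoffel_12_1 \<phi> p) * u' * v'\<^sup>2
       - christoffel_22_1 \<phi> p * v' ^ 3
       + u' * v'' - u'' * v') * sqrt (metric_det \<phi> p))"

definition homothetic_invariant_on :: "real set \<Rightarrow> (real \<Rightarrow> real) \<Rightarrow> (real \<Rightarrow> real) \<Rightarrow> bool" where
  "homothetic_invariant_on I f fbar \<longleftrightarrow> (\<exists>k. k \<notin> {0, 1} \<and> (\<forall>s\<in>I. fbar s = k\<^sup>2 * f s))"

end

theory Submission
  imports Defs
begin

text \<open>Geodesic curvature is an intrinsic quantity. For a unit speed curve it equals
  \<open>\<alpha>'' \<bullet> (U \<times> \<alpha>') = U \<bullet> (\<alpha>' \<times> \<alpha>'')\<close>, and since \<open>U\<close> is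
  \<open>\<phi>\<^sub>u \<times> \<phi>\<^sub>v\<close> divided by \<open>sqrt (EG - F\<^sup>2)\<close>, the Binet-Cauchy identity for
  two cross products turns this into inner products of the derivatives of \<open>\<phi>\<close>. The inner
  products of a first with a second derivative of \<open>\<phi>\<close> are combinations of the first
  derivatives of \<open>E\<close>, \<open>F\<close>, \<open>G\<close>, and collecting terms gives the classical
  expression in Christoffel symbols: this is \<open>geodesic_curvature_eq_expr\<close>. The step needs
  \<open>\<phi>\<^sub>u\<^sub>v = \<phi>\<^sub>v\<^sub>u\<close>, which is \<open>partial_u_partial_v_commute\<close>.

  The coordinate expression depends on the surface only through \<open>E\<close>, \<open>F\<close>,
  \<open>G\<close> and their first derivatives. When these are all multiplied by a constant
  \<open>r > 0\<close>, numerator and denominator of each Christoffel symbol are multiplied by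
  \<open>r\<^sup>2\<close>, so the symbols do not change, while \<open>sqrt (EG - F\<^sup>2)\<close> is multiplied
  by \<open>r\<close>: this is \<open>geodesic_curvature_expr_scaling\<close>. A homothetic map of dilation
  factor \<open>c\<close> has \<open>r = c\<^sup>2\<close>, so \<open>k = c\<close> is the required constant.\<close>

section \<open>Derivatives of smooth maps\<close>

text \<open>On an open set all iterated derivatives are local, so smoothness depends only on the values
  there. This allows passing from Frechet derivatives, in terms of which smoothness is defined, to
  \<open>deriv\<close> and to partial derivatives, which agree with them on that set only.\<close>

lemma Ck_on_cong:
  assumes "open S" and "\<And>x. x \<in> S \<Longrightarrow> f x = g x" and "Ck_on k S f"
  shows "Ck_on k S g"
  using assms(2,3)
proof (induction k arbitrary: f g)
  case 0
  then show ?case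
    by (metis Ck_on.simps(1) continuous_on_cong)
next
  case (Suc k)
  have diff: "f differentiable (at x)" if "x \<in> S" for x
    using Suc.prems(2) that assms(1) by (simp add: differentiable_on_eq_differentiable_at)
  have "g differentiable_on S"
    using Suc.prems by (auto simp: differentiable_on_def intro: differentiable_transform_within[where d=1])
  moreover have "Ck_on k S (\<lambda>x. frechet_derivative g (at x) b)" if "b \<in> Basis" for b
  proof (rule Suc.IH[of "\<lambda>x. frechet_derivative f (at x) b"])
    show "frechet_derivative f (at x) b = frechet_derivative g (at x) b" if "x \<in> S" for x
      using frechet_derivative_transform_within_open[OF diff[OF that] assms(1) that Suc.prems(1)]
      by simp
    show "Ck_on k S (\<lambda>x. frechet_derivative f (at x) b)"
      using Suc.prems(2) that by simp
  qed
  ultimately show ?case by simp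
qed

lemma smooth_on_cong:
  assumes "open S" and "\<And>x. x \<in> S \<Longrightarrow> f x = g x" and "smooth_on S f"
  shows "smooth_on S g"
  using assms Ck_on_cong unfolding smooth_on_def by blast

lemma smooth_on_frechet_derivative:
  assumes "smooth_on S f" and "b \<in> Basis"
  shows "smooth_on S (\<lambda>x. frechet_derivative f (at x) b)"
  using assms unfolding smooth_on_def by (metis Ck_on.simps(2))

lemma smooth_on_continuous_on: "smooth_on S f \<Longrightarrow> continuous_on S f"
  unfolding smooth_on_def by (metis Ck_on.simps(1))

lemma smooth_on_has_derivative:
  assumes "open S" and "smooth_on S f" and "x \<in> S"
  shows "(f has_derivative frechet_derivative f (at x)) (at x)"
proof -
  have "Ck_on (Suc 0) S f"
    using assms(2) unfolding smooth_on_def by blast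
  then show ?thesis
    using assms(1,3) by (simp add: differentiable_on_eq_differentiable_at frechet_derivative_works[symmetric])
qed

lemma smooth_on_has_real_derivative:
  fixes f :: "real \<Rightarrow> real"
  assumes "open S" and "smooth_on S f" and "x \<in> S"
  shows "(f has_real_derivative deriv f x) (at x)"
  using smooth_on_has_derivative[OF assms] differentiable_def DERIV_deriv_iff_real_differentiable
  by blast

lemma smooth_on_deriv:
  fixes f :: "real \<Rightarrow> real"
  assumes "open S" and "smooth_on S f"
  shows "smooth_on S (deriv f)"
proof (rule smooth_on_cong[OF assms(1)])
  show "smooth_on S (\<lambda>x. frechet_derivative f (at x) 1)"
    using assms(2) by (rule smooth_on_frechet_derivative) simp
  show "frechet_derivative f (at x) 1 = deriv f x" if "x \<in> S" for x
    using smooth_on_has_real_derivative[OF assms that]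
    by (metis frechet_derivative_at has_field_derivative_def mult.right_neutral)
qed

section \<open>Partial derivatives\<close>

lemma has_partial_u:
  assumes "(f has_derivative f') (at p)"
  shows "((\<lambda>t. f (t, snd p)) has_vector_derivative f' (1, 0)) (at (fst p))"
proof -
  have "((\<lambda>t. (t, snd p)) has_vector_derivative (1, 0)) (at (fst p))"
    by (auto intro!: derivative_eq_intros simp: has_vector_derivative_def)
  from vector_derivative_diff_chain_within[OF this, of f f'] show ?thesis
    using assms by (simp add: o_def has_derivative_at_withinI)
qed

lemma has_partial_v:
  assumes "(f has_derivative f') (at p)"
  shows "((\<lambda>t. f (fst p, t)) has_vector_derivative f' (0, 1)) (at (snd p))"
proof -
  have "((\<lambda>t. (fst p, t)) has_vector_derivative (0, 1)) (at (snd p))"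
    by (auto intro!: derivative_eq_intros simp: has_vector_derivative_def)
  from vector_derivative_diff_chain_within[OF this, of f f'] show ?thesis
    using assms by (simp add: o_def has_derivative_at_withinI)
qed

lemma partial_eq_derivative:
  assumes "(f has_derivative f') (at p)"
  shows "partial_u f p = f' (1, 0)" and "partial_v f p = f' (0, 1)"
  unfolding partial_u_def partial_v_def
  using has_partial_u[OF assms] has_partial_v[OF assms] by (auto intro: vector_derivative_at)

lemma smooth_on_has_partials:
  assumes "open D" and "smooth_on D f" and "p \<in> D"
  shows "((\<lambda>t. f (t, snd p)) has_vector_derivative partial_u f p) (at (fst p))"
    and "((\<lambda>t. f (fst p, t)) has_vector_derivative partial_v f p) (at (snd p))"
proof -
  note d = smooth_on_has_derivative[OF assms]
  show "((\<lambda>t. f (t, snd p)) has_vector_derivative partial_u f p) (at (fst p))"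
    using has_partial_u[OF d] partial_eq_derivative[OF d] by simp
  show "((\<lambda>t. f (fst p, t)) has_vector_derivative partial_v f p) (at (snd p))"
    using has_partial_v[OF d] partial_eq_derivative[OF d] by simp
qed

lemma smooth_on_partials:
  assumes "open D" and "smooth_on D f"
  shows "smooth_on D (partial_u f)" and "smooth_on D (partial_v f)"
proof -
  have "smooth_on D (\<lambda>x. frechet_derivative f (at x) (1, 0))"
    "smooth_on D (\<lambda>x. frechet_derivative f (at x) (0, 1))"
    using assms(2) by (auto intro!: smooth_on_frechet_derivative simp: Basis_prod_def)
  note d = this
  show "smooth_on D (partial_u f)"
    by (rule smooth_on_cong[OF assms(1) _ d(1)])
      (simp add: partial_eq_derivative(1)[OF smooth_on_has_derivative[OF assms]])
  show "smooth_on D (partial_v f)"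
    by (rule smooth_on_cong[OF assms(1) _ d(2)])
      (simp add: partial_eq_derivative(2)[OF smooth_on_has_derivative[OF assms]])
qed

lemma smooth_on_chain_rule:
  assumes "open D" and "smooth_on D f" and "(u s, v s) \<in> D"
    and "(u has_real_derivative u') (at s)" and "(v has_real_derivative v') (at s)"
  shows "((\<lambda>t. f (u t, v t)) has_vector_derivative
      u' *\<^sub>R partial_u f (u s, v s) + v' *\<^sub>R partial_v f (u s, v s)) (at s)"
proof -
  let ?f' = "frechet_derivative f (at (u s, v s))"
  have d: "(f has_derivative ?f') (at (u s, v s))"
    using smooth_on_has_derivative[OF assms(1-3)] .
  have "((\<lambda>t. (u t, v t)) has_vector_derivative (u', v')) (at s)"
    using assms(4,5) by (intro has_vector_derivative_Pair) (auto simp: has_real_derivative_iff_has_vector_derivative)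
  from vector_derivative_diff_chain_within[OF this, of f ?f']
  have "((\<lambda>t. f (u t, v t)) has_vector_derivative ?f' (u', v')) (at s)"
    (is "(_ has_vector_derivative ?w) _")
    using d by (simp add: o_def has_derivative_at_withinI)
  also have "?w = ?f' (u' *\<^sub>R (1, 0) + v' *\<^sub>R (0, 1))"
    by simp
  also have "\<dots> = u' *\<^sub>R ?f' (1, 0) + v' *\<^sub>R ?f' (0, 1)"
    unfolding linear_add[OF has_derivative_linear[OF d]] linear_scale[OF has_derivative_linear[OF d]] ..
  finally show ?thesis
    unfolding partial_eq_derivative[OF d] .
qed

text \<open>The mean value theorem, applied first to \<open>f (\<cdot>) (b+h) - f (\<cdot>) b\<close> and then
  to \<open>fx x\<close>. The left-hand side is symmetric in the two variables, which is what makes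
  mixed derivatives commute.\<close>

lemma second_difference_eq_mixed_derivative:
  fixes f fx fxy :: "real \<Rightarrow> real \<Rightarrow> real"
  assumes "h > 0"
    and fx: "\<And>x y. x \<in> {a..a+h} \<Longrightarrow> y \<in> {b..b+h} \<Longrightarrow> ((\<lambda>t. f t y) has_real_derivative fx x y) (at x)"
    and fxy: "\<And>x y. x \<in> {a..a+h} \<Longrightarrow> y \<in> {b..b+h} \<Longrightarrow> (fx x has_real_derivative fxy x y) (at y)"
  obtains x y where "x \<in> {a..a+h}" and "y \<in> {b..b+h}"
    and "f (a+h) (b+h) - f (a+h) b - f a (b+h) + f a b = h * h * fxy x y"
proof -
  have "\<exists>x. a < x \<and> x < a + h \<and>
      (f (a+h) (b+h) - f (a+h) b) - (f a (b+h) - f a b) = (a+h-a) * (fx x (b+h) - fx x b)"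
    using assms(1) by (intro MVT2) (auto intro!: DERIV_diff fx)
  then obtain x where x: "a < x" "x < a + h"
    "f (a+h) (b+h) - f (a+h) b - (f a (b+h) - f a b) = h * (fx x (b+h) - fx x b)"
    by auto
  have "\<exists>y. b < y \<and> y < b + h \<and> fx x (b+h) - fx x b = (b+h-b) * fxy x y"
    using assms(1) x by (intro MVT2) (auto intro!: fxy)
  then obtain y where y: "b < y" "y < b + h" "fx x (b+h) - fx x b = h * fxy x y"
    by auto
  have "f (a+h) (b+h) - f (a+h) b - f a (b+h) + f a b
      = f (a+h) (b+h) - f (a+h) b - (f a (b+h) - f a b)"
    by simp
  also have "\<dots> = h * h * fxy x y"
    unfolding x(3) y(3) by simp
  finally show ?thesis
    using x y by (intro that[of x y]) auto
qed

text \<open>Schwarz's theorem. If the mixed derivatives differed at \<open>p\<close>, so would their components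
  along their difference \<open>w\<close>, and by continuity these components would stay apart on a small
  square with corner \<open>p\<close>. But both take, at some points of the square, the value of the
  same second difference quotient.\<close>

lemma partial_u_partial_v_commute:
  fixes f :: "real \<times> real \<Rightarrow> 'b::real_inner"
  assumes D: "open D" and f: "smooth_on D f" and p: "p \<in> D"
  shows "partial_v (partial_u f) p = partial_u (partial_v f) p"
proof (rule ccontr)
  define g where "g = partial_v (partial_u f)"
  define k where "k = partial_u (partial_v f)"
  define w where "w = g p - k p"
  assume "partial_v (partial_u f) p \<noteq> partial_u (partial_v f) p"
  then have "w \<bullet> w > 0"
    by (simp add: w_def g_def k_def)
  note fu = smooth_on_partials(1)[OF D f] and fv = smooth_on_partials(2)[OF D f]
  have cont: "continuous_on D (\<lambda>q. g q \<bullet> w)" "continuous_on D (\<lambda>q. k q \<bullet> w)"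
    unfolding g_def k_def
    using smooth_on_continuous_on[OF smooth_on_partials(2)[OF D fu]]
      smooth_on_continuous_on[OF smooth_on_partials(1)[OF D fv]]
    by (auto intro: continuous_on_inner)
  define e where "e = ((g p - k p) \<bullet> w) / 2"
  have "e > 0" using \<open>w \<bullet> w > 0\<close> by (simp add: e_def w_def)
  obtain S where S: "open S" "p \<in> S" "S \<subseteq> D"
    "\<And>q. q \<in> S \<Longrightarrow> \<bar>g q \<bullet> w - g p \<bullet> w\<bar> < e" "\<And>q. q \<in> S \<Longrightarrow> \<bar>k q \<bullet> w - k p \<bullet> w\<bar> < e"
  proof
    let ?S = "((\<lambda>q. g q \<bullet> w) -` ball (g p \<bullet> w) e \<inter> D) \<inter> ((\<lambda>q. k q \<bullet> w) -` ball (k p \<bullet> w) e \<inter> D)"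
    show "open ?S"
      using cont[unfolded continuous_on_open_vimage[OF D], THEN spec, THEN mp, OF open_ball]
      by (rule open_Int)
    show "p \<in> ?S" using \<open>e > 0\<close> p by simp
    show "?S \<subseteq> D" by auto
    show "\<bar>g q \<bullet> w - g p \<bullet> w\<bar> < e" "\<bar>k q \<bullet> w - k p \<bullet> w\<bar> < e" if "q \<in> ?S" for q
      using that by (auto simp: dist_real_def)
  qed
  obtain a b where ab: "p = (a, b)" by (cases p)
  obtain A B where AB: "open A" "open B" "(a, b) \<in> A \<times> B" "A \<times> B \<subseteq> S"
    using S(1,2) ab by (auto elim!: open_prod_elim)
  obtain r1 where r1: "r1 > 0" "cball a r1 \<subseteq> A"
    using AB open_contains_cball by blast
  obtain r2 where r2: "r2 > 0" "cball b r2 \<subseteq> B"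
    using AB open_contains_cball by blast
  define h where "h = min r1 r2"
  have h: "h > 0" using r1 r2 by (simp add: h_def)
  have "{a..a+h} \<subseteq> cball a r1" "{b..b+h} \<subseteq> cball b r2"
    by (auto simp: h_def dist_real_def)
  then have sq: "(x, y) \<in> S" "(x, y) \<in> D" if "x \<in> {a..a+h}" "y \<in> {b..b+h}" for x y
    using that r1 r2 AB S(3) by blast+
  have du: "((\<lambda>t. F (t, y) \<bullet> w) has_real_derivative partial_u F (x, y) \<bullet> w) (at x)"
    and dv: "((\<lambda>t. F (x, t) \<bullet> w) has_real_derivative partial_v F (x, y) \<bullet> w) (at y)"
    if "smooth_on D F" "(x, y) \<in> D" for F :: "real \<times> real \<Rightarrow> 'b" and x y
    using smooth_on_has_partials[OF D that]
    by (auto simp: has_real_derivative_iff_has_vector_derivative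
        intro: bounded_linear.has_vector_derivative[OF bounded_linear_inner_left])
  obtain x y where xy: "x \<in> {a..a+h}" "y \<in> {b..b+h}"
    "f (a+h, b+h) \<bullet> w - f (a+h, b) \<bullet> w - f (a, b+h) \<bullet> w + f (a, b) \<bullet> w = h * h * (g (x, y) \<bullet> w)"
    by (rule second_difference_eq_mixed_derivative[OF h, of a b "\<lambda>x y. f (x, y) \<bullet> w"
          "\<lambda>x y. partial_u f (x, y) \<bullet> w" "\<lambda>x y. g (x, y) \<bullet> w"])
      (auto simp: g_def intro!: du[OF f] dv[OF fu] sq)
  obtain y' x' where xy': "y' \<in> {b..b+h}" "x' \<in> {a..a+h}"
    "f (a+h, b+h) \<bullet> w - f (a, b+h) \<bullet> w - f (a+h, b) \<bullet> w + f (a, b) \<bullet> w = h * h * (k (x', y') \<bullet> w)"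
    by (rule second_difference_eq_mixed_derivative[OF h, of b a "\<lambda>y x. f (x, y) \<bullet> w"
          "\<lambda>y x. partial_v f (x, y) \<bullet> w" "\<lambda>y x. k (x, y) \<bullet> w"])
      (auto simp: k_def intro!: dv[OF f] du[OF fv] sq)
  have "h * h * (g (x, y) \<bullet> w) = h * h * (k (x', y') \<bullet> w)"
    using xy(3) xy'(3) by linarith
  then have "g (x, y) \<bullet> w = k (x', y') \<bullet> w"
    using h by simp
  moreover have "\<bar>g (x, y) \<bullet> w - g p \<bullet> w\<bar> < e" "\<bar>k (x', y') \<bullet> w - k p \<bullet> w\<bar> < e"
    using S(4,5) sq xy xy' by blast+
  moreover have "g p \<bullet> w - k p \<bullet> w = 2 * e"
    by (simp add: e_def inner_diff_left)
  ultimately show False by linarith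
qed

section \<open>The first fundamental form and its derivatives\<close>

lemma has_partials_inner:
  assumes D: "open D" and f: "smooth_on D f" and g: "smooth_on D g" and p: "p \<in> D"
  shows "((\<lambda>t. f (t, snd p) \<bullet> g (t, snd p)) has_vector_derivative
      f p \<bullet> partial_u g p + partial_u f p \<bullet> g p) (at (fst p))"
    and "((\<lambda>t. f (fst p, t) \<bullet> g (fst p, t)) has_vector_derivative
      f p \<bullet> partial_v g p + partial_v f p \<bullet> g p) (at (snd p))"
  using bounded_bilinear.has_vector_derivative[OF bounded_bilinear_inner
      smooth_on_has_partials(1)[OF D f p] smooth_on_has_partials(1)[OF D g p]]
    bounded_bilinear.has_vector_derivative[OF bounded_bilinear_inner
      smooth_on_has_partials(2)[OF D f p] smooth_on_has_partials(2)[OF D g p]]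
  by simp_all

lemma partials_inner:
  assumes "open D" and "smooth_on D f" and "smooth_on D g" and "p \<in> D"
  shows "partial_u (\<lambda>q. f q \<bullet> g q) p = f p \<bullet> partial_u g p + partial_u f p \<bullet> g p"
    and "partial_v (\<lambda>q. f q \<bullet> g q) p = f p \<bullet> partial_v g p + partial_v f p \<bullet> g p"
  unfolding partial_u_def[of "\<lambda>q. f q \<bullet> g q"] partial_v_def[of "\<lambda>q. f q \<bullet> g q"]
  using has_partials_inner[OF assms] by (auto intro: vector_derivative_at)

text \<open>The relation between \<open>k\<close> and the inner product is assumed on the open set only, because a
  homothetic map controls the first fundamental form of the image patch only over the domain of
  the patch.\<close>

lemma partials_scaled_inner:
  assumes D: "open D" and f: "smooth_on D f" and g: "smooth_on D g" and p: "p \<in> D"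
    and k: "\<And>q. q \<in> D \<Longrightarrow> k q = r * (f q \<bullet> g q)"
  shows "partial_u k p = r * partial_u (\<lambda>q. f q \<bullet> g q) p"
    and "partial_v k p = r * partial_v (\<lambda>q. f q \<bullet> g q) p"
proof -
  have "((\<lambda>t. k (t, snd p)) has_vector_derivative
      r * (f p \<bullet> partial_u g p + partial_u f p \<bullet> g p)) (at (fst p))"
  proof (rule has_vector_derivative_transform_within_open)
    show "((\<lambda>t. r * (f (t, snd p) \<bullet> g (t, snd p))) has_vector_derivative
        r * (f p \<bullet> partial_u g p + partial_u f p \<bullet> g p)) (at (fst p))"
      using has_partials_inner(1)[OF D f g p] by (rule has_vector_derivative_mult_right)
    show "open ((\<lambda>t. (t, snd p)) -` D)"
      by (intro open_vimage D continuous_intros)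
  qed (use k p in auto)
  then show "partial_u k p = r * partial_u (\<lambda>q. f q \<bullet> g q) p"
    using partials_inner(1)[OF D f g p] vector_derivative_at by (metis partial_u_def)
  have "((\<lambda>t. k (fst p, t)) has_vector_derivative
      r * (f p \<bullet> partial_v g p + partial_v f p \<bullet> g p)) (at (snd p))"
  proof (rule has_vector_derivative_transform_within_open)
    show "((\<lambda>t. r * (f (fst p, t) \<bullet> g (fst p, t))) has_vector_derivative
        r * (f p \<bullet> partial_v g p + partial_v f p \<bullet> g p)) (at (snd p))"
      using has_partials_inner(2)[OF D f g p] by (rule has_vector_derivative_mult_right)
    show "open ((\<lambda>t. (fst p, t)) -` D)"
      by (intro open_vimage D continuous_intros)
  qed (use k p in auto)
  then show "partial_v k p = r * partial_v (\<lambda>q. f q \<bullet> g q) p"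
    using partials_inner(2)[OF D f g p] vector_derivative_at by (metis partial_v_def)
qed

lemma metric_det_eq_norm_cross:
  "metric_det \<phi> p = (norm (cross3 (partial_u \<phi> p) (partial_v \<phi> p)))\<^sup>2"
  unfolding metric_det_def coef_E_def coef_F_def coef_G_def
  by (simp add: norm_cross power2_norm_eq_inner[symmetric])

section \<open>Geodesic curvature in coordinates\<close>

text \<open>Here \<open>a\<close>, \<open>U\<close> and \<open>U \<times> a\<close> form an orthonormal basis, and
  \<open>x\<close> has no component along \<open>a\<close>. With \<open>a\<close>, \<open>x\<close> the
  velocity and acceleration of a unit speed curve, this evaluates the definite description that
  defines the geodesic curvature.\<close>

lemma the_coefficient_in_adapted_frame:
  fixes a x U :: "real^3"
  assumes "norm a = 1" and "norm U = 1" and "U \<bullet> a = 0" and "x \<bullet> a = 0"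
  shows "(THE k. \<exists>m. x = m *\<^sub>R U + k *\<^sub>R cross3 U a) = x \<bullet> cross3 U a"
proof (rule the_equality)
  define w where "w = cross3 U a"
  have n: "a \<bullet> a = 1" "U \<bullet> U = 1"
    using assms(1,2) by (simp_all add: dot_square_norm)
  have w: "U \<bullet> w = 0" "w \<bullet> U = 0" "a \<bullet> w = 0" "w \<bullet> w = 1"
    unfolding w_def using n assms(3) by (simp_all add: dot_cross_self inner_commute dot_cross)
  define y where "y = x - ((x \<bullet> U) *\<^sub>R U + (x \<bullet> w) *\<^sub>R w)"
  have y: "y \<bullet> U = 0" "y \<bullet> a = 0" "y \<bullet> w = 0"
    unfolding y_def using n w assms(3,4)
    by (simp_all add: inner_diff_left inner_add_left inner_commute[of w a])
  \<comment> \<open>The remainder \<open>y\<close> is orthogonal to \<open>a\<close> and \<open>U\<close>, hence parallel to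
    \<open>w\<close>, as well as orthogonal to \<open>w\<close>.\<close>
  have "cross3 y w = 0"
    unfolding w_def using y by (simp add: Lagrange)
  then have "y = 0"
    using norm_cross_dot[of y w] y(3) w(4) by auto
  then show "\<exists>m. x = m *\<^sub>R U + (x \<bullet> cross3 U a) *\<^sub>R cross3 U a"
    unfolding y_def w_def by (intro exI[of _ "x \<bullet> U"]) simp
  show "k = x \<bullet> cross3 U a" if "\<exists>m. x = m *\<^sub>R U + k *\<^sub>R cross3 U a" for k
    using that w unfolding w_def[symmetric] by (auto simp: inner_add_left)
qed

lemma surface_curve_velocity_acceleration:
  assumes D: "open D" and f: "smooth_on D \<phi>" and I: "open I"
    and u: "smooth_on I u" and v: "smooth_on I v"
    and in_D: "\<forall>s\<in>I. (u s, v s) \<in> D" and s: "s \<in> I"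
  defines "p \<equiv> (u s, v s)" and "\<alpha> \<equiv> \<lambda>t. \<phi> (u t, v t)"
  shows "velocity \<alpha> s = deriv u s *\<^sub>R partial_u \<phi> p + deriv v s *\<^sub>R partial_v \<phi> p" (is ?vel)
    and "(velocity \<alpha> has_vector_derivative acceleration \<alpha> s) (at s)" (is ?acc)
    and "acceleration \<alpha> s =
      deriv (deriv u) s *\<^sub>R partial_u \<phi> p + deriv (deriv v) s *\<^sub>R partial_v \<phi> p
      + (deriv u s)\<^sup>2 *\<^sub>R partial_u (partial_u \<phi>) p
      + (2 * deriv u s * deriv v s) *\<^sub>R partial_v (partial_u \<phi>) p
      + (deriv v s)\<^sup>2 *\<^sub>R partial_v (partial_v \<phi>) p" (is ?acc_eq)
proof -
  note u1 = smooth_on_has_real_derivative[OF I u] and v1 = smooth_on_has_real_derivative[OF I v]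
  note u2 = smooth_on_has_real_derivative[OF I smooth_on_deriv[OF I u] s]
    and v2 = smooth_on_has_real_derivative[OF I smooth_on_deriv[OF I v] s]
  have vel: "velocity \<alpha> t = deriv u t *\<^sub>R partial_u \<phi> (u t, v t) + deriv v t *\<^sub>R partial_v \<phi> (u t, v t)"
    if "t \<in> I" for t
    unfolding velocity_def \<alpha>_def
    using smooth_on_chain_rule[OF D f in_D[rule_format, OF that] u1[OF that] v1[OF that]]
    by (rule vector_derivative_at)
  then show ?vel using s by (simp add: p_def)
  let ?A = "deriv u s *\<^sub>R (deriv u s *\<^sub>R partial_u (partial_u \<phi>) p + deriv v s *\<^sub>R partial_v (partial_u \<phi>) p)
      + deriv (deriv u) s *\<^sub>R partial_u \<phi> p
      + (deriv v s *\<^sub>R (deriv u s *\<^sub>R partial_u (partial_v \<phi>) p + deriv v s *\<^sub>R partial_v (partial_v \<phi>) p)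
      + deriv (deriv v) s *\<^sub>R partial_v \<phi> p)"
  \<comment> \<open>Product rule, and the chain rule again for each of the two first partial derivatives.\<close>
  have "((\<lambda>t. deriv u t *\<^sub>R partial_u \<phi> (u t, v t) + deriv v t *\<^sub>R partial_v \<phi> (u t, v t))
      has_vector_derivative ?A) (at s)"
    unfolding p_def
    by (intro has_vector_derivative_add has_vector_derivative_scaleR u2 v2
        smooth_on_chain_rule[OF D smooth_on_partials(1)[OF D f] in_D[rule_format, OF s] u1[OF s] v1[OF s]]
        smooth_on_chain_rule[OF D smooth_on_partials(2)[OF D f] in_D[rule_format, OF s] u1[OF s] v1[OF s]])
  then have A: "(velocity \<alpha> has_vector_derivative ?A) (at s)"
    by (rule has_vector_derivative_transform_within_open[OF _ I s]) (simp add: vel)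
  then have eq: "acceleration \<alpha> s = ?A"
    unfolding acceleration_def velocity_def[of "velocity \<alpha>"] by (rule vector_derivative_at)
  then show ?acc using A by simp
  have mixed: "partial_u (partial_v \<phi>) p = partial_v (partial_u \<phi>) p"
    using partial_u_partial_v_commute[OF D f] in_D[rule_format, OF s] by (simp add: p_def)
  have double: "(2 * deriv u s * deriv v s) *\<^sub>R w
      = (deriv u s * deriv v s) *\<^sub>R w + (deriv u s * deriv v s) *\<^sub>R w" for w :: "real^3"
    unfolding scaleR_left_distrib[symmetric] by (rule arg_cong[of _ _ "\<lambda>r. r *\<^sub>R w"]) linarith
  show ?acc_eq
    unfolding eq mixed double power2_eq_square scaleR_add_right scaleR_scaleR
      mult.commute[of "deriv v s" "deriv u s"]
    by (simp only: add_ac)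
qed

text \<open>In the proof \<open>W\<close> is the length of \<open>\<phi>\<^sub>u \<times> \<phi>\<^sub>v\<close>, that is, the root
  of the metric determinant. Multiplied by \<open>W\<^sup>2\<close>, every Christoffel symbol is a polynomial
  in inner products of derivatives of \<open>\<phi>\<close>, so the claim multiplied by \<open>W\<close>
  becomes a polynomial identity.\<close>

lemma geodesic_curvature_eq_expr:
  assumes patch: "surface_patch M D \<phi>" and I: "open I"
    and u: "smooth_on I u" and v: "smooth_on I v"
    and in_D: "\<forall>s\<in>I. (u s, v s) \<in> D"
    and unit: "unit_speed_on I (\<lambda>s. \<phi> (u s, v s))" and s: "s \<in> I"
  shows "geodesic_curvature \<phi> u v s = geodesic_curvature_expr \<phi> u v s"
proof -
  define p where "p = (u s, v s)"
  define \<alpha> where "\<alpha> = (\<lambda>t. \<phi> (u t, v t))"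
  define a where "a = partial_u \<phi> p"
  define b where "b = partial_v \<phi> p"
  define auu where "auu = partial_u (partial_u \<phi>) p"
  define auv where "auv = partial_v (partial_u \<phi>) p"
  define avv where "avv = partial_v (partial_v \<phi>) p"
  define U where "U = unit_normal \<phi> p"
  define W where "W = norm (cross3 a b)"
  define x y x2 y2 where "x = deriv u s" "y = deriv v s" "x2 = deriv (deriv u) s" "y2 = deriv (deriv v) s"
  note xy_def = this
  have D: "open D" and f: "smooth_on D \<phi>" and reg: "cross3 a b \<noteq> 0"
    using patch in_D[rule_format, OF s] by (auto simp: surface_patch_def a_def b_def p_def)
  have p: "p \<in> D" using in_D[rule_format, OF s] by (simp add: p_def)
  have W: "W > 0" using reg by (simp add: W_def)
  note va = surface_curve_velocity_acceleration[OF D f I u v in_D, folded \<alpha>_def]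
  have vel: "velocity \<alpha> s = x *\<^sub>R a + y *\<^sub>R b"
    using va(1)[OF s] by (simp add: xy_def a_def b_def p_def)
  have acc: "acceleration \<alpha> s = x2 *\<^sub>R a + y2 *\<^sub>R b + x\<^sup>2 *\<^sub>R auu + (2 * x * y) *\<^sub>R auv + y\<^sup>2 *\<^sub>R avv"
    using va(3)[OF s] by (simp add: xy_def a_def b_def p_def auu_def auv_def avv_def)
  have speed: "norm (velocity \<alpha> t) = 1" if "t \<in> I" for t
    using unit that by (simp add: unit_speed_on_def \<alpha>_def)
  \<comment> \<open>Differentiate the constant squared speed.\<close>
  have orth: "acceleration \<alpha> s \<bullet> velocity \<alpha> s = 0"
  proof -
    note d = va(2)[OF s]
    have "((\<lambda>t. velocity \<alpha> t \<bullet> velocity \<alpha> t) has_vector_derivative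
        velocity \<alpha> s \<bullet> acceleration \<alpha> s + acceleration \<alpha> s \<bullet> velocity \<alpha> s) (at s)"
      using bounded_bilinear.has_vector_derivative[OF bounded_bilinear_inner d d] by simp
    moreover have "((\<lambda>t. velocity \<alpha> t \<bullet> velocity \<alpha> t) has_vector_derivative 0) (at s)"
      by (rule has_vector_derivative_transform_within_open[OF _ I s, of "\<lambda>t. 1"])
        (simp_all add: speed dot_square_norm)
    ultimately have "velocity \<alpha> s \<bullet> acceleration \<alpha> s + acceleration \<alpha> s \<bullet> velocity \<alpha> s = 0"
      by (rule vector_derivative_unique_at)
    then show ?thesis
      by (simp add: inner_commute)
  qed
  have U_eq: "U = cross3 a b /\<^sub>R W"
    by (simp add: U_def unit_normal_def a_def b_def W_def)
  have U: "norm U = 1" "U \<bullet> velocity \<alpha> s = 0"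
    using W unfolding U_eq vel by (simp_all add: W_def inner_add_right dot_cross_self)
  have det: "metric_det \<phi> p = W\<^sup>2"
    by (simp add: metric_det_eq_norm_cross W_def a_def b_def)
  note fu = smooth_on_partials(1)[OF D f] and fv = smooth_on_partials(2)[OF D f]
  have avu: "partial_u (partial_v \<phi>) p = auv"
    using partial_u_partial_v_commute[OF D f p] by (simp add: auv_def)
  have E: "coef_E \<phi> p = a \<bullet> a" "partial_u (coef_E \<phi>) p = 2 * (a \<bullet> auu)" "partial_v (coef_E \<phi>) p = 2 * (a \<bullet> auv)"
    using partials_inner[OF D fu fu p]
    by (simp_all add: coef_E_def[abs_def] a_def auu_def auv_def inner_commute)
  have F: "coef_F \<phi> p = a \<bullet> b" "partial_u (coef_F \<phi>) p = a \<bullet> auv + b \<bullet> auu"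
    "partial_v (coef_F \<phi>) p = a \<bullet> avv + b \<bullet> auv"
    using partials_inner[OF D fu fv p] avu
    by (simp_all add: coef_F_def[abs_def] a_def b_def auu_def auv_def avv_def inner_commute)
  have G: "coef_G \<phi> p = b \<bullet> b" "partial_u (coef_G \<phi>) p = 2 * (b \<bullet> auv)" "partial_v (coef_G \<phi>) p = 2 * (b \<bullet> avv)"
    using partials_inner[OF D fv fv p] avu
    by (simp_all add: coef_G_def[abs_def] b_def auv_def avv_def inner_commute)
  have W2: "W\<^sup>2 = (a \<bullet> a) * (b \<bullet> b) - (a \<bullet> b)\<^sup>2"
    using det by (simp add: metric_det_def E F G)
  have "geodesic_curvature \<phi> u v s = acceleration \<alpha> s \<bullet> cross3 U (velocity \<alpha> s)"
    using the_coefficient_in_adapted_frame[OF speed[OF s] U orth]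
    by (simp add: geodesic_curvature_def Let_def \<alpha>_def U_def p_def)
  also have "\<dots> = U \<bullet> cross3 (velocity \<alpha> s) (acceleration \<alpha> s)"
    by (metis cross_triple inner_commute)
  also have "\<dots> = ((a \<bullet> velocity \<alpha> s) * (b \<bullet> acceleration \<alpha> s) - (a \<bullet> acceleration \<alpha> s) * (b \<bullet> velocity \<alpha> s)) / W"
    by (simp add: U_eq dot_cross divide_inverse mult.commute)
  also have "\<dots> = geodesic_curvature_expr \<phi> u v s"
  proof -
    have chr:
      "christoffel_11_1 \<phi> p * W\<^sup>2 = (b \<bullet> b) * (a \<bullet> auu) - (a \<bullet> b) * (b \<bullet> auu)"
      "christoffel_11_2 \<phi> p * W\<^sup>2 = (a \<bullet> a) * (b \<bullet> auu) - (a \<bullet> b) * (a \<bullet> auu)"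
      "christoffel_12_1 \<phi> p * W\<^sup>2 = (b \<bullet> b) * (a \<bullet> auv) - (a \<bullet> b) * (b \<bullet> auv)"
      "christoffel_12_2 \<phi> p * W\<^sup>2 = (a \<bullet> a) * (b \<bullet> auv) - (a \<bullet> b) * (a \<bullet> auv)"
      "christoffel_22_1 \<phi> p * W\<^sup>2 = (b \<bullet> b) * (a \<bullet> avv) - (a \<bullet> b) * (b \<bullet> avv)"
      "christoffel_22_2 \<phi> p * W\<^sup>2 = (a \<bullet> a) * (b \<bullet> avv) - (a \<bullet> b) * (a \<bullet> avv)"
      unfolding christoffel_11_1_def christoffel_11_2_def christoffel_12_1_def christoffel_12_2_def
        christoffel_22_1_def christoffel_22_2_def det E F G
      using W by (simp_all add: divide_simps) (simp_all add: algebra_simps)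
    have expr: "geodesic_curvature_expr \<phi> u v s =
        (christoffel_11_2 \<phi> p * x ^ 3 + (2 * christoffel_12_2 \<phi> p - christoffel_11_1 \<phi> p) * x\<^sup>2 * y
         + (christoffel_22_2 \<phi> p - 2 * christoffel_12_1 \<phi> p) * x * y\<^sup>2
         - christoffel_22_1 \<phi> p * y ^ 3 + x * y2 - x2 * y) * W"
      using W by (simp add: geodesic_curvature_expr_def Let_def det xy_def flip: p_def)
    have "geodesic_curvature_expr \<phi> u v s * W =
        (christoffel_11_2 \<phi> p * W\<^sup>2) * x ^ 3
        + (2 * (christoffel_12_2 \<phi> p * W\<^sup>2) - christoffel_11_1 \<phi> p * W\<^sup>2) * x\<^sup>2 * y
        + (christoffel_22_2 \<phi> p * W\<^sup>2 - 2 * (christoffel_12_1 \<phi> p * W\<^sup>2)) * x * y\<^sup>2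
        - (christoffel_22_1 \<phi> p * W\<^sup>2) * y ^ 3 + (x * y2 - x2 * y) * W\<^sup>2"
      unfolding expr by (simp add: algebra_simps power2_eq_square)
    also have "\<dots> = (a \<bullet> velocity \<alpha> s) * (b \<bullet> acceleration \<alpha> s)
        - (a \<bullet> acceleration \<alpha> s) * (b \<bullet> velocity \<alpha> s)"
      unfolding chr unfolding W2 vel acc inner_add_right inner_scaleR_right
      by (simp add: inner_commute[of b a] algebra_simps power2_eq_square power3_eq_cube)
    finally show ?thesis
      using W by (simp add: divide_simps)
  qed
  finally show ?thesis .
qed

section \<open>Homothetic change of the coordinate expression\<close>

lemma geodesic_curvature_expr_scaling:
  assumes D: "open D" and f: "smooth_on D \<phi>" and p: "(u s, v s) \<in> D" and r: "r > 0"
    and E: "\<And>q. q \<in> D \<Longrightarrow> coef_E \<psi> q = r * coef_E \<phi> q"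
    and F: "\<And>q. q \<in> D \<Longrightarrow> coef_F \<psi> q = r * coef_F \<phi> q"
    and G: "\<And>q. q \<in> D \<Longrightarrow> coef_G \<psi> q = r * coef_G \<phi> q"
  shows "geodesic_curvature_expr \<psi> u v s = r * geodesic_curvature_expr \<phi> u v s"
proof -
  define p where "p = (u s, v s)"
  have pD: "p \<in> D" using p by (simp add: p_def)
  note fu = smooth_on_partials(1)[OF D f] and fv = smooth_on_partials(2)[OF D f]
  have dE: "partial_u (coef_E \<psi>) p = r * partial_u (coef_E \<phi>) p"
    "partial_v (coef_E \<psi>) p = r * partial_v (coef_E \<phi>) p"
    using partials_scaled_inner[OF D fu fu pD, of "coef_E \<psi>" r] E by (simp_all add: coef_E_def[abs_def])
  have dF: "partial_u (coef_F \<psi>) p = r * partial_u (coef_F \<phi>) p"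
    "partial_v (coef_F \<psi>) p = r * partial_v (coef_F \<phi>) p"
    using partials_scaled_inner[OF D fu fv pD, of "coef_F \<psi>" r] F by (simp_all add: coef_F_def[abs_def])
  have dG: "partial_u (coef_G \<psi>) p = r * partial_u (coef_G \<phi>) p"
    "partial_v (coef_G \<psi>) p = r * partial_v (coef_G \<phi>) p"
    using partials_scaled_inner[OF D fv fv pD, of "coef_G \<psi>" r] G by (simp_all add: coef_G_def[abs_def])
  note c = E[OF pD] F[OF pD] G[OF pD] dE dF dG
  have det: "metric_det \<psi> p = r\<^sup>2 * metric_det \<phi> p"
    by (simp add: metric_det_def c power2_eq_square algebra_simps)
  \<comment> \<open>The Christoffel numerators are quadratic in \<open>E\<close>, \<open>F\<close>, \<open>G\<close> and their
    derivatives, just as the determinant is.\<close>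
  have quot: "(r\<^sup>2 * n) / (2 * (r\<^sup>2 * d)) = n / (2 * d)" for n d :: real
    using r by simp
  have chr: "christoffel_11_1 \<psi> p = christoffel_11_1 \<phi> p" "christoffel_11_2 \<psi> p = christoffel_11_2 \<phi> p"
    "christoffel_12_1 \<psi> p = christoffel_12_1 \<phi> p" "christoffel_12_2 \<psi> p = christoffel_12_2 \<phi> p"
    "christoffel_22_1 \<psi> p = christoffel_22_1 \<phi> p" "christoffel_22_2 \<psi> p = christoffel_22_2 \<phi> p"
    unfolding christoffel_11_1_def christoffel_11_2_def christoffel_12_1_def christoffel_12_2_def
      christoffel_22_1_def christoffel_22_2_def det
    by (subst quot[symmetric], simp add: c power2_eq_square algebra_simps)+
  have "sqrt (metric_det \<psi> p) = r * sqrt (metric_det \<phi> p)"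
    using r by (simp add: det real_sqrt_mult)
  then show ?thesis
    by (simp add: geodesic_curvature_expr_def Let_def chr flip: p_def)
qed

theorem corollary3p13:
  fixes M Mbar :: "(real^3) set"
    and J :: "real^3 \<Rightarrow> real^3"
    and c :: real
    and D :: "(real \<times> real) set"
    and \<phi> :: "real \<times> real \<Rightarrow> real^3"
    and I :: "real set"
    and u v :: "real \<Rightarrow> real"
    and \<alpha> :: "real \<Rightarrow> real^3"
  assumes "smooth_surface M" and "smooth_surface Mbar"
    and "homothetic_map M Mbar c J" and "c \<notin> {0, 1}"
    and "surface_patch M D \<phi>"
    and "open I" and "is_interval I"
    and "smooth_on I u" and "smooth_on I v"
    and "\<forall>s\<in>I. (u s, v s) \<in> D"
    and "\<alpha> = (\<lambda>s. \<phi> (u s, v s))"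
    and "unit_speed_on I \<alpha>"
    and "rectifying_curve I \<alpha>"
    and "rectifying_curve I (J \<circ> \<alpha>)"
  shows "homothetic_invariant_on I (geodesic_curvature \<phi> u v)
           (geodesic_curvature_expr (J \<circ> \<phi>) u v)"
  unfolding homothetic_invariant_on_def
proof (intro exI[of _ c] conjI ballI)
  show "c \<notin> {0, 1}" by fact
  fix s assume s: "s \<in> I"
  have "geodesic_curvature \<phi> u v s = geodesic_curvature_expr \<phi> u v s"
    using assms(5,6,8-12) s by (intro geodesic_curvature_eq_expr) auto
  moreover have "geodesic_curvature_expr (J \<circ> \<phi>) u v s = c\<^sup>2 * geodesic_curvature_expr \<phi> u v s"
    using assms(3,4,5,10) s
    by (intro geodesic_curvature_expr_scaling[of D]) (auto simp: surface_patch_def homothetic_map_def)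
  ultimately show "geodesic_curvature_expr (J \<circ> \<phi>) u v s = c\<^sup>2 * geodesic_curvature \<phi> u v s"
    by simp
qed

end
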